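(* For all $\alpha\in(0,\infty]$, all $p\in(0,1)$ and all $X\in\mathcal X_\alpha$, $$Q_\alpha(X;p)=\inf_{t\in T_\alpha}B_\alpha(X;p)(t),$$ where $T_\alpha:=\mathbb R$ if $\alpha\in(0,\infty)$, $T_\infty:=(0,\infty)$, and $$B_\alpha(X;p)(t):=t+\frac{\|(X-t)_+\|_\alpha}{p^{1/\alpha}}\ \text{ for }\alpha\in(0,\infty),\qquad B_\infty(X;p)(t):=t\,\ln\frac{\mathsf E e^{X/t}}{p}.$$
   Context: For real $u$, $u_+:=\max(0,u)$, $u_+^\alpha:=(u_+)^\alpha$; $\|Z\|_\alpha:=(\mathsf E|Z|^\alpha)^{1/\alpha}$ for $\alpha\in(0,\infty)$. Define $h_\alpha(u)=(1+u/\alpha)_+^\alpha$ for $0<\alpha<\infty$ and $h_\infty(u)=e^u$, $u\in\mathbb R$. For a random variable $X$, $x\in\mathbb R$, $p\in(0,1)$ put $$P_\alpha(X;x):=\inf_{\lambda\in(0,\infty)}\mathsf E\,h_\alpha(\lambda(X-x)),\qquad Q_\alpha(X;p):=\inf\{x\in\mathbb R:P_\alpha(X;x)<p\}.$$ For $\alpha\in(0,\infty)$, $\mathcal X_\alpha$ is the set of real-valued random variables $X$ with $\mathsf E X_+^\alpha<\infty$; $\mathcal X_\infty$ is the set of those with $\mathsf E e^{\lambda X}<\infty$ for some real $\lambda>0$. ($B_\infty(X;p)(t)=\infty$ if $\mathsf E e^{X/t}=\infty$.) *)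

theory Defs
  imports "HOL-Probability.Probability"
begin

text \<open>
  The exponent \<open>\<alpha>\<close> is an extended real, meant to satisfy \<open>0 < \<alpha> \<le> \<infinity>\<close>.
  Since all expectations are of nonnegative random variables and may be infinite, they are
  rendered by the nonnegative Lebesgue integral with values in \<open>[0,\<infinity>]\<close>.
  Note that \<open>0 powr a = 0\<close>, as required for \<open>u\<^sub>+\<^sup>a\<close> with \<open>a > 0\<close>.
\<close>

definition h :: "ereal \<Rightarrow> real \<Rightarrow> real" where
  "h \<alpha> u = (if \<alpha> = \<infinity> then exp u
            else max 0 (1 + u / real_of_ereal \<alpha>) powr real_of_ereal \<alpha>)"

definition P_bound :: "'a measure \<Rightarrow> ereal \<Rightarrow> ('a \<Rightarrow> real) \<Rightarrow> real \<Rightarrow> ennreal" where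
  "P_bound M \<alpha> X x = (INF l\<in>{0<..}. \<integral>\<^sup>+ \<omega>. ennreal (h \<alpha> (l * (X \<omega> - x))) \<partial>M)"

text \<open>
  The infimum is taken in the extended reals, so that it is the usual one
  for every set of reals, including empty and unbounded sets.
\<close>

definition Q_bound :: "'a measure \<Rightarrow> ereal \<Rightarrow> ('a \<Rightarrow> real) \<Rightarrow> real \<Rightarrow> ereal" where
  "Q_bound M \<alpha> X p = (INF x\<in>{x :: real. P_bound M \<alpha> X x < ennreal p}. ereal x)"

definition X_class :: "'a measure \<Rightarrow> ereal \<Rightarrow> ('a \<Rightarrow> real) set" where
  "X_class M \<alpha> = {X \<in> borel_measurable M.
     if \<alpha> = \<infinity> then \<exists>l>0. (\<integral>\<^sup>+ \<omega>. ennreal (exp (l * X \<omega>)) \<partial>M) < \<infinity>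
     else (\<integral>\<^sup>+ \<omega>. ennreal (max 0 (X \<omega>) powr real_of_ereal \<alpha>) \<partial>M) < \<infinity>}"

definition L_norm :: "'a measure \<Rightarrow> real \<Rightarrow> ('a \<Rightarrow> real) \<Rightarrow> ereal" where
  "L_norm M a Z = (let E = \<integral>\<^sup>+ \<omega>. ennreal (\<bar>Z \<omega>\<bar> powr a) \<partial>M
     in if E = \<infinity> then \<infinity> else ereal (enn2real E powr (1 / a)))"

definition T_set :: "ereal \<Rightarrow> real set" where
  "T_set \<alpha> = (if \<alpha> = \<infinity> then {0<..} else UNIV)"

definition B_fun :: "'a measure \<Rightarrow> ereal \<Rightarrow> ('a \<Rightarrow> real) \<Rightarrow> real \<Rightarrow> real \<Rightarrow> ereal" where
  "B_fun M \<alpha> X p t =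
     (if \<alpha> = \<infinity> then
        (let E = \<integral>\<^sup>+ \<omega>. ennreal (exp (X \<omega> / t)) \<partial>M
         in if E = \<infinity> then \<infinity> else ereal (t * ln (enn2real E / p)))
      else ereal t + L_norm M (real_of_ereal \<alpha>) (\<lambda>\<omega>. max 0 (X \<omega> - t))
                       / ereal (p powr (1 / real_of_ereal \<alpha>)))"

end

theory Submission
  imports Defs
begin

text \<open>
  Pass to strict sublevel sets: \<open>P_bound M \<alpha> X x < p\<close> holds iff some \<open>t \<in> T_set \<alpha>\<close> has
  \<open>B_fun M \<alpha> X p t < x\<close>. The link between the two parameters is \<open>\<lambda> = \<alpha> / (x - t)\<close> for finite
  \<open>\<alpha>\<close>, because then \<open>1 + \<lambda> (u - x) / \<alpha> = (u - t) / (x - t)\<close>, and \<open>\<lambda> = 1 / t\<close> for \<open>\<alpha> = \<infinity>\<close>.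
\<close>

text \<open>By density of the reals in the extended reals, a real strictly between
  \<open>B t\<close> and the left-hand infimum would itself lie in the set and contradict that
  infimum. This covers empty \<open>T\<close> and infinite values of \<open>B\<close> as
  well.\<close>

lemma INF_strict_upper_bounds_ereal:
  fixes B :: "'b \<Rightarrow> ereal"
  shows "(INF x\<in>{x::real. \<exists>t\<in>T. B t < ereal x}. ereal x) = (INF t\<in>T. B t)"
proof (rule antisym)
  show "(INF x\<in>{x::real. \<exists>t\<in>T. B t < ereal x}. ereal x) \<le> (INF t\<in>T. B t)"
  proof (rule INF_greatest, rule ccontr)
    fix t assume t: "t \<in> T"
    assume "\<not> (INF x\<in>{x::real. \<exists>t\<in>T. B t < ereal x}. ereal x) \<le> B t"
    then obtain x :: real where x: "B t < ereal x"
      "ereal x < (INF x\<in>{x::real. \<exists>t\<in>T. B t < ereal x}. ereal x)"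
      unfolding not_le by (blast dest: ereal_dense2)
    have "(INF x\<in>{x::real. \<exists>t\<in>T. B t < ereal x}. ereal x) \<le> ereal x"
      using t x(1) by (intro INF_lower) auto
    with x(2) show False by simp
  qed
  show "(INF t\<in>T. B t) \<le> (INF x\<in>{x::real. \<exists>t\<in>T. B t < ereal x}. ereal x)"
    by (rule INF_greatest) (auto intro: INF_lower2 less_imp_le)
qed

lemma P_bound_less_iff:
  "P_bound M \<alpha> X x < c \<longleftrightarrow> (\<exists>l>0. (\<integral>\<^sup>+ \<omega>. ennreal (h \<alpha> (l * (X \<omega> - x))) \<partial>M) < c)"
  unfolding P_bound_def INF_less_iff by auto

text \<open>Clears the positive factor and moves to real arithmetic. The guard
  \<open>E \<noteq> \<infinity>\<close> is essential because \<open>enn2real\<close> sends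
  \<infinity> to 0; it mirrors the case split in \<open>L_norm\<close> and
  \<open>B_fun\<close>.\<close>

lemma ennreal_mult_less_iff_enn2real:
  assumes "0 < c"
  shows "ennreal (1 / c) * E < ennreal p \<longleftrightarrow> E \<noteq> \<infinity> \<and> enn2real E < p * c"
proof (cases E)
  case (real r)
  then have "ennreal (1 / c) * E = ennreal (r / c)"
    using assms by (simp flip: ennreal_mult)
  then show ?thesis
    using real assms by (simp add: ennreal_less_iff pos_divide_less_eq)
next
  case top
  then show ?thesis using assms by (simp add: ennreal_mult_top)
qed

text \<open>The positive factor \<open>1 / (x - t)\<close> passes through the positive part and then
  through the power. The absolute value makes the last factor literally the integrand of
  \<open>L_norm\<close>.\<close>

lemma h_finite_rescale:
  assumes "0 < a" "t < x"
  shows "h (ereal a) (a / (x - t) * (u - x))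
    = 1 / (x - t) powr a * \<bar>max 0 (u - t)\<bar> powr a"
proof -
  have "1 + a / (x - t) * (u - x) / a = (u - t) / (x - t)"
    using assms by (simp add: field_simps)
  moreover have "max 0 ((u - t) / (x - t)) = max 0 (u - t) / (x - t)"
    using assms by (simp add: max_def divide_le_0_iff zero_le_divide_iff)
  ultimately show ?thesis
    using assms by (simp add: h_def powr_divide)
qed

text \<open>The norm term is nonnegative, so t is at most \<open>B_fun\<close> at t. Hence, although
  \<open>T_set\<close> is all of the reals here, only t with \<open>a / (x - t)\<close> positive
  matter.\<close>

lemma B_fun_finite_gt:
  assumes "0 < a" "0 < p" "B_fun M (ereal a) X p t < ereal x"
  shows "t < x"
proof (rule ccontr)
  assume "\<not> t < x"
  moreover have "0 \<le> L_norm M a (\<lambda>\<omega>. max 0 (X \<omega> - t)) / ereal (p powr (1 / a))"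
    using assms by (auto simp: L_norm_def Let_def)
  then have "ereal t \<le> B_fun M (ereal a) X p t"
    by (simp add: B_fun_def add_increasing2)
  ultimately show False
    using assms(3) by (metis ereal_less_eq(3) not_le order.trans)
qed

text \<open>Writing E for the a-th moment of the positive part of X - t, both sides say E < p (x -
  t)^a: the left one after raising to the power a, the right one by
  \<open>h_finite_rescale\<close>.\<close>

lemma B_fun_finite_less_iff:
  assumes a: "0 < a" and p: "0 < p" and X: "X \<in> borel_measurable M" and tx: "t < x"
  shows "B_fun M (ereal a) X p t < ereal x \<longleftrightarrow>
    (\<integral>\<^sup>+ \<omega>. ennreal (h (ereal a) (a / (x - t) * (X \<omega> - x))) \<partial>M) < ennreal p"
proof -
  define E where "E = (\<integral>\<^sup>+ \<omega>. ennreal (\<bar>max 0 (X \<omega> - t)\<bar> powr a) \<partial>M)"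
  have "(\<integral>\<^sup>+ \<omega>. ennreal (h (ereal a) (a / (x - t) * (X \<omega> - x))) \<partial>M)
      = (\<integral>\<^sup>+ \<omega>. ennreal (1 / (x - t) powr a) * ennreal (\<bar>max 0 (X \<omega> - t)\<bar> powr a) \<partial>M)"
    using a tx by (subst h_finite_rescale) (auto simp: ennreal_mult' simp del: times_divide_eq_left)
  also have "\<dots> = ennreal (1 / (x - t) powr a) * E"
    unfolding E_def using X by (intro nn_integral_cmult) measurable
  finally have "(\<integral>\<^sup>+ \<omega>. ennreal (h (ereal a) (a / (x - t) * (X \<omega> - x))) \<partial>M) < ennreal p
      \<longleftrightarrow> E \<noteq> \<infinity> \<and> enn2real E < p * (x - t) powr a"
    using tx by (simp only: ennreal_mult_less_iff_enn2real powr_gt_zero)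
  also have "\<dots> \<longleftrightarrow> B_fun M (ereal a) X p t < ereal x"
  proof (cases "E = \<infinity>")
    case True
    then have "B_fun M (ereal a) X p t = \<infinity>"
      using p by (simp add: B_fun_def L_norm_def E_def)
    with True show ?thesis by simp
  next
    case False
    define e where "e = enn2real E"
    have e: "0 \<le> e" by (simp add: e_def)
    have "B_fun M (ereal a) X p t = ereal (t + e powr (1 / a) / p powr (1 / a))"
      using False p by (simp add: B_fun_def L_norm_def E_def e_def Let_def)
    then have "B_fun M (ereal a) X p t < ereal x
        \<longleftrightarrow> e powr (1 / a) < p powr (1 / a) * (x - t)"
      using p by (simp add: field_simps)
    also have "p powr (1 / a) * (x - t) = (p * (x - t) powr a) powr (1 / a)"
      using a p tx by (simp add: powr_mult powr_powr)
    \<comment> \<open>Strict monotonicity of the root gives one direction; weak monotonicity, read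
      contrapositively, gives the other.\<close>
    also have "e powr (1 / a) < \<dots> \<longleftrightarrow> e < p * (x - t) powr a"
      using a p tx e powr_less_mono2[of "1 / a" e "p * (x - t) powr a"]
        powr_mono2[of "1 / a" "p * (x - t) powr a" e]
      by (auto simp: not_le[symmetric])
    finally show ?thesis using False by (simp add: e_def)
  qed
  finally show ?thesis ..
qed

lemma P_bound_finite_less_iff:
  assumes a: "0 < a" and p: "0 < p" and X: "X \<in> borel_measurable M"
  shows "P_bound M (ereal a) X x < ennreal p \<longleftrightarrow> (\<exists>t. B_fun M (ereal a) X p t < ereal x)"
proof
  assume "P_bound M (ereal a) X x < ennreal p"
  then obtain l where l: "0 < l"
    "(\<integral>\<^sup>+ \<omega>. ennreal (h (ereal a) (l * (X \<omega> - x))) \<partial>M) < ennreal p"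
    by (auto simp: P_bound_less_iff)
  \<comment> \<open>The witness solves \<open>l = a / (x - t)\<close> for t.\<close>
  have "x - a / l < x" "a / (x - (x - a / l)) = l" using a l(1) by simp_all
  with B_fun_finite_less_iff[OF a p X, of "x - a / l" x] l(2)
  show "\<exists>t. B_fun M (ereal a) X p t < ereal x" by auto
next
  assume "\<exists>t. B_fun M (ereal a) X p t < ereal x"
  then obtain t where t: "B_fun M (ereal a) X p t < ereal x" ..
  have "t < x" using B_fun_finite_gt[OF a p t] .
  with t a show "P_bound M (ereal a) X x < ennreal p"
    unfolding P_bound_less_iff B_fun_finite_less_iff[OF a p X \<open>t < x\<close>]
    by (intro exI[of _ "a / (x - t)"]) simp
qed

text \<open>A nonnegative integral vanishes only if its integrand is zero almost everywhere; an
  exponential is nowhere zero and the space has mass 1.\<close>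

lemma (in prob_space) nn_integral_exp_pos:
  assumes "Y \<in> borel_measurable M"
  shows "0 < (\<integral>\<^sup>+ \<omega>. ennreal (exp (Y \<omega>)) \<partial>M)"
proof -
  have "\<not> (AE \<omega> in M. False)" by simp
  then have "(\<integral>\<^sup>+ \<omega>. ennreal (exp (Y \<omega>)) \<partial>M) \<noteq> 0"
    using assms by (subst nn_integral_0_iff_AE) (simp_all add: not_le[symmetric] ennreal_eq_0_iff)
  then show ?thesis by (simp add: zero_less_iff_neq_zero)
qed

text \<open>With E the expectation of exp (X / t), both sides say E < p exp (x / t): the left one by
  dividing by t > 0 and exponentiating, the right one by pulling out the constant exp (- x /
  t).\<close>

lemma (in prob_space) B_fun_infinity_less_iff:
  assumes t: "0 < t" and p: "0 < p" and X: "X \<in> borel_measurable M"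
  shows "B_fun M \<infinity> X p t < ereal x \<longleftrightarrow>
    (\<integral>\<^sup>+ \<omega>. ennreal (h \<infinity> (1 / t * (X \<omega> - x))) \<partial>M) < ennreal p"
proof -
  define E where "E = (\<integral>\<^sup>+ \<omega>. ennreal (exp (X \<omega> / t)) \<partial>M)"
  have "(\<integral>\<^sup>+ \<omega>. ennreal (h \<infinity> (1 / t * (X \<omega> - x))) \<partial>M)
      = (\<integral>\<^sup>+ \<omega>. ennreal (1 / exp (x / t)) * ennreal (exp (X \<omega> / t)) \<partial>M)"
    by (simp add: h_def diff_divide_distrib exp_diff ennreal_mult'[symmetric])
  also have "\<dots> = ennreal (1 / exp (x / t)) * E"
    unfolding E_def using X by (intro nn_integral_cmult) simp
  finally have "(\<integral>\<^sup>+ \<omega>. ennreal (h \<infinity> (1 / t * (X \<omega> - x))) \<partial>M) < ennreal p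
      \<longleftrightarrow> E \<noteq> \<infinity> \<and> enn2real E < p * exp (x / t)"
    by (simp only: ennreal_mult_less_iff_enn2real exp_gt_zero)
  also have "\<dots> \<longleftrightarrow> B_fun M \<infinity> X p t < ereal x"
  proof (cases "E = \<infinity>")
    case True
    then show ?thesis by (simp add: B_fun_def E_def)
  next
    case False
    define e where "e = enn2real E"
    \<comment> \<open>Positivity makes \<open>ln (e / p)\<close> a genuine logarithm, which
      \<open>exp_ln\<close> can undo below.\<close>
    have "0 < E" unfolding E_def using X by (intro nn_integral_exp_pos) simp
    then have e: "0 < e" using False by (simp add: e_def enn2real_positive_iff top.not_eq_extremum)
    have "B_fun M \<infinity> X p t < ereal x \<longleftrightarrow> ln (e / p) < x / t"
      using False t by (simp add: B_fun_def E_def e_def Let_def field_simps)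
    also have "\<dots> \<longleftrightarrow> e / p < exp (x / t)"
      using e p by (metis divide_pos_pos exp_less_cancel_iff exp_ln)
    finally show ?thesis using False p by (simp add: e_def field_simps)
  qed
  finally show ?thesis ..
qed

text \<open>The map t to 1 / t is a bijection of the positive reals, so the two existential
  quantifiers range over matching parameters.\<close>

lemma (in prob_space) P_bound_infinity_less_iff:
  assumes p: "0 < p" and X: "X \<in> borel_measurable M"
  shows "P_bound M \<infinity> X x < ennreal p \<longleftrightarrow> (\<exists>t>0. B_fun M \<infinity> X p t < ereal x)"
proof
  assume "P_bound M \<infinity> X x < ennreal p"
  then obtain l where l: "0 < l"
    "(\<integral>\<^sup>+ \<omega>. ennreal (h \<infinity> (l * (X \<omega> - x))) \<partial>M) < ennreal p"
    by (auto simp: P_bound_less_iff)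
  with B_fun_infinity_less_iff[of "1 / l", OF _ p X]
  show "\<exists>t>0. B_fun M \<infinity> X p t < ereal x"
    by (intro exI[of _ "1 / l"]) simp
next
  assume "\<exists>t>0. B_fun M \<infinity> X p t < ereal x"
  then obtain t where t: "0 < t" "B_fun M \<infinity> X p t < ereal x" by blast
  then show "P_bound M \<infinity> X x < ennreal p"
    unfolding P_bound_less_iff B_fun_infinity_less_iff[OF t(1) p X]
    by (intro exI[of _ "1 / t"]) simp
qed

theorem theorem2p3:
  fixes M :: "'a measure" and X :: "'a \<Rightarrow> real" and \<alpha> :: ereal and p :: real
  assumes "prob_space M"
    and "0 < \<alpha>"
    and "0 < p" and "p < 1"
    and "X \<in> X_class M \<alpha>"
  shows "Q_bound M \<alpha> X p = (INF t\<in>T_set \<alpha>. B_fun M \<alpha> X p t)"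
proof -
  interpret prob_space M by fact
  have X: "X \<in> borel_measurable M" using assms(5) by (simp add: X_class_def)
  have "P_bound M \<alpha> X x < ennreal p \<longleftrightarrow> (\<exists>t\<in>T_set \<alpha>. B_fun M \<alpha> X p t < ereal x)" for x
  proof (cases \<alpha>)
    case (real a)
    then show ?thesis
      using P_bound_finite_less_iff[of a p X M x] X assms(2,3) by (simp add: T_set_def)
  next
    case PInf
    then show ?thesis
      using P_bound_infinity_less_iff[OF assms(3) X] by (auto simp: T_set_def)
  next
    case MInf
    then show ?thesis using assms(2) by simp
  qed
  \<comment> \<open>The index set in \<open>Q_bound\<close> has become the set of strict real upper
    bounds of values of \<open>B_fun\<close>.\<close>
  then show ?thesis
    unfolding Q_bound_def by (simp only: INF_strict_upper_bounds_ereal)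
qed

end
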